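(* The Dominating Set, Total Dominating Set, and Connected Dominating Set problems are solvable in time $\mathcal{O}(|V(G)|^3)$ on split graphs $G$ that have no induced subgraph isomorphic to $H$.
   Context: A split graph is a graph whose vertex set can be partitioned into a clique and an independent set. A dominating set of $G$ is a set $D\subseteq V(G)$ such that every vertex is in $D$ or has a neighbor in $D$; a total dominating set is a set $D$ such that every vertex has a neighbor in $D$; a connected dominating set is a dominating set inducing a connected subgraph. The three problems ask for a minimum-size set of the respective kind. $H$ is the graph on vertices $c_1,c_2,x_1,y_1,x_2,y_2$ with edges $c_1c_2,c_1x_1,c_1y_1,c_2x_2,c_2y_2$. *)

theory Defs
  imports Complex_Main "HOL-Library.Landau_Symbols"
begin

section \<open>Finite simple graphs\<close>

record 'a graph =
  verts :: "'a set"
  edges :: "'a set set"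

definition simple_graph :: "'a graph \<Rightarrow> bool" where
  "simple_graph G \<longleftrightarrow> finite (verts G) \<and> edges G \<subseteq> {e. e \<subseteq> verts G \<and> card e = 2}"

definition adj :: "'a graph \<Rightarrow> 'a \<Rightarrow> 'a \<Rightarrow> bool" where
  "adj G u v \<longleftrightarrow> {u, v} \<in> edges G"

definition clique :: "'a graph \<Rightarrow> 'a set \<Rightarrow> bool" where
  "clique G K \<longleftrightarrow> K \<subseteq> verts G \<and> (\<forall>u\<in>K. \<forall>v\<in>K. u \<noteq> v \<longrightarrow> adj G u v)"

definition independent_set :: "'a graph \<Rightarrow> 'a set \<Rightarrow> bool" where
  "independent_set G I \<longleftrightarrow> I \<subseteq> verts G \<and> (\<forall>u\<in>I. \<forall>v\<in>I. \<not> adj G u v)"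

text \<open>Either part of the partition may be empty.\<close>

definition split_graph :: "'a graph \<Rightarrow> bool" where
  "split_graph G \<longleftrightarrow> simple_graph G \<and>
     (\<exists>K I. K \<union> I = verts G \<and> K \<inter> I = {} \<and> clique G K \<and> independent_set G I)"

definition induced_subgraph :: "'a graph \<Rightarrow> 'a set \<Rightarrow> 'a graph" where
  "induced_subgraph G S = \<lparr>verts = S, edges = {e \<in> edges G. e \<subseteq> S}\<rparr>"

definition graph_isomorphic :: "'a graph \<Rightarrow> 'b graph \<Rightarrow> bool" where
  "graph_isomorphic G G' \<longleftrightarrow>
     (\<exists>f. bij_betw f (verts G) (verts G') \<and>
          (\<forall>u\<in>verts G. \<forall>v\<in>verts G. adj G u v \<longleftrightarrow> adj G' (f u) (f v)))"

definition induced_free :: "'b graph \<Rightarrow> 'a graph \<Rightarrow> bool" where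
  "induced_free F G \<longleftrightarrow>
     \<not> (\<exists>S. S \<subseteq> verts G \<and> graph_isomorphic (induced_subgraph G S) F)"

datatype hvert = C1 | C2 | X1 | Y1 | X2 | Y2

definition H_graph :: "hvert graph" where
  "H_graph = \<lparr>verts = {C1, C2, X1, Y1, X2, Y2},
              edges = {{C1, C2}, {C1, X1}, {C1, Y1}, {C2, X2}, {C2, Y2}}\<rparr>"

lemma simple_graph_H_graph: "simple_graph H_graph"
  by (auto simp: simple_graph_def H_graph_def)

text \<open>The graph without vertices counts as connected.\<close>

definition connected_graph :: "'a graph \<Rightarrow> bool" where
  "connected_graph G \<longleftrightarrow>
     (\<forall>u\<in>verts G. \<forall>v\<in>verts G. (u, v) \<in> {(x, y). adj G x y}\<^sup>*)"


section \<open>The three domination problems\<close>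

definition dominating_set :: "'a graph \<Rightarrow> 'a set \<Rightarrow> bool" where
  "dominating_set G D \<longleftrightarrow> D \<subseteq> verts G \<and> (\<forall>v\<in>verts G. v \<in> D \<or> (\<exists>u\<in>D. adj G v u))"

definition total_dominating_set :: "'a graph \<Rightarrow> 'a set \<Rightarrow> bool" where
  "total_dominating_set G D \<longleftrightarrow> D \<subseteq> verts G \<and> (\<forall>v\<in>verts G. \<exists>u\<in>D. adj G v u)"

definition connected_dominating_set :: "'a graph \<Rightarrow> 'a set \<Rightarrow> bool" where
  "connected_dominating_set G D \<longleftrightarrow>
     dominating_set G D \<and> connected_graph (induced_subgraph G D)"

definition minimum_set :: "('a graph \<Rightarrow> 'a set \<Rightarrow> bool) \<Rightarrow> 'a graph \<Rightarrow> 'a set \<Rightarrow> bool" where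
  "minimum_set P G D \<longleftrightarrow> P G D \<and> (\<forall>D'. P G D' \<longrightarrow> card D \<le> card D')"


section \<open>Unit-cost word RAM\<close>

text \<open>
  Running time is measured on a word RAM with registers and an indirectly addressed
  memory, programmed with structured control flow. Every executed instruction and
  every evaluated test costs one step.
\<close>

record ram_state =
  reg :: "nat \<Rightarrow> nat"
  mem :: "nat \<Rightarrow> nat"

text \<open>
  The arguments are register numbers, except for the literal in the second argument
  of \<open>LoadConst\<close>. \<open>Load r a\<close> copies the memory cell whose address is in register \<open>a\<close>
  to register \<open>r\<close>; \<open>Store a r\<close> copies register \<open>r\<close> to that cell. Subtraction is truncated.
\<close>

datatype com =
    Skip
  | LoadConst nat nat
  | Add nat nat nat
  | Sub nat nat nat
  | Mul nat nat nat
  | Load nat nat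
  | Store nat nat
  | Seq com com
  | IfLess nat nat com com
  | WhileLess nat nat com

abbreviation set_reg :: "nat \<Rightarrow> nat \<Rightarrow> ram_state \<Rightarrow> ram_state" where
  "set_reg r x s \<equiv> s\<lparr>reg := (reg s)(r := x)\<rparr>"

text \<open>
  \<open>exec B c s t s'\<close>: started in \<open>s\<close>, program \<open>c\<close> halts in \<open>s'\<close> after exactly \<open>t\<close> steps,
  on a machine whose words hold the numbers below \<open>B\<close>. An instruction whose result does
  not fit into a word has no execution, so that large numbers cannot be used to
  perform many operations at unit cost.
\<close>

inductive exec :: "nat \<Rightarrow> com \<Rightarrow> ram_state \<Rightarrow> nat \<Rightarrow> ram_state \<Rightarrow> bool" for B :: nat where
  Skip: "exec B Skip s 1 s"
| LoadConst: "x < B \<Longrightarrow> exec B (LoadConst r x) s 1 (set_reg r x s)"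
| Add: "reg s i + reg s j < B \<Longrightarrow> exec B (Add r i j) s 1 (set_reg r (reg s i + reg s j) s)"
| Sub: "reg s i - reg s j < B \<Longrightarrow> exec B (Sub r i j) s 1 (set_reg r (reg s i - reg s j) s)"
| Mul: "reg s i * reg s j < B \<Longrightarrow> exec B (Mul r i j) s 1 (set_reg r (reg s i * reg s j) s)"
| Load: "mem s (reg s a) < B \<Longrightarrow> exec B (Load r a) s 1 (set_reg r (mem s (reg s a)) s)"
| Store: "reg s r < B \<Longrightarrow> exec B (Store a r) s 1 (s\<lparr>mem := (mem s)(reg s a := reg s r)\<rparr>)"
| Seq: "exec B c1 s t1 s1 \<Longrightarrow> exec B c2 s1 t2 s2 \<Longrightarrow> exec B (Seq c1 c2) s (t1 + t2) s2"
| IfTrue: "reg s i < reg s j \<Longrightarrow> exec B c1 s t s' \<Longrightarrow> exec B (IfLess i j c1 c2) s (1 + t) s'"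
| IfFalse: "\<not> reg s i < reg s j \<Longrightarrow> exec B c2 s t s' \<Longrightarrow> exec B (IfLess i j c1 c2) s (1 + t) s'"
| WhileFalse: "\<not> reg s i < reg s j \<Longrightarrow> exec B (WhileLess i j c) s 1 s"
| WhileTrue: "reg s i < reg s j \<Longrightarrow> exec B c s t1 s1 \<Longrightarrow> exec B (WhileLess i j c) s1 t2 s2 \<Longrightarrow>
    exec B (WhileLess i j c) s (1 + t1 + t2) s2"

inductive_cases exec_elims:
  "exec B Skip s t s'" "exec B (LoadConst r x) s t s'"
  "exec B (Add r i j) s t s'" "exec B (Sub r i j) s t s'" "exec B (Mul r i j) s t s'"
  "exec B (Load r a) s t s'" "exec B (Store a r) s t s'" "exec B (Seq c1 c2) s t s'"
  "exec B (IfLess i j c1 c2) s t s'" "exec B (WhileLess i j c) s t s'"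

lemma exec_deterministic:
  "exec B c s t s' \<Longrightarrow> exec B c s t2 s2 \<Longrightarrow> t2 = t \<and> s2 = s'"
proof (induction arbitrary: t2 s2 rule: exec.induct)
  case (Seq c1 s t1 s1 c2 t2' s2')
  from Seq.prems obtain u1 r u2
    where "exec B c1 s u1 r" "exec B c2 r u2 s2" "t2 = u1 + u2" by (rule exec_elims)
  with Seq.IH show ?case by metis
next
  case (WhileTrue s i j c t1 s1 t2' s2')
  from WhileTrue.prems WhileTrue.hyps(1) obtain u1 r u2
    where "exec B c s u1 r" "exec B (WhileLess i j c) r u2 s2" "t2 = 1 + u1 + u2"
    by (auto elim: exec_elims(10))
  with WhileTrue.IH show ?case by metis
next
  case (IfTrue s i j c1 t s' c2)
  from IfTrue.prems IfTrue.hyps(1) obtain u where "exec B c1 s u s2" "t2 = 1 + u"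
    by (auto elim: exec_elims(9))
  with IfTrue.IH show ?case by metis
next
  case (IfFalse s i j c2 t s' c1)
  from IfFalse.prems IfFalse.hyps(1) obtain u where "exec B c2 s u s2" "t2 = 1 + u"
    by (auto elim: exec_elims(9))
  with IfFalse.IH show ?case by metis
qed (erule exec_elims; simp)+


section \<open>Solving minimisation problems on graphs\<close>

text \<open>
  The input is a graph with vertex set \<open>{..<n}\<close>: register 0 contains \<open>n\<close>, and memory cell
  \<open>i * n + j\<close> contains the entry of the adjacency matrix at \<open>i, j < n\<close>. Everything else
  is initially 0.
\<close>

definition input_state :: "nat graph \<Rightarrow> nat \<Rightarrow> ram_state" where
  "input_state G n =
     \<lparr>reg = (\<lambda>r. if r = 0 then n else 0),
      mem = (\<lambda>a. if a < n * n \<and> adj G (a div n) (a mod n) then 1 else 0)\<rparr>"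

text \<open>
  The output is a vertex set, given by its characteristic vector in the \<open>n\<close> cells after
  the matrix, or the answer that there is no feasible set, signalled by register 0 being 0.
  Such instances exist: a graph with an isolated vertex has no total dominating set.
\<close>

definition decode_output :: "nat \<Rightarrow> ram_state \<Rightarrow> nat set option" where
  "decode_output n s = (if reg s 0 = 0 then None else Some {v. v < n \<and> mem s (n * n + v) \<noteq> 0})"

definition correct_answer ::
  "(nat graph \<Rightarrow> nat set \<Rightarrow> bool) \<Rightarrow> nat graph \<Rightarrow> nat set option \<Rightarrow> bool" where
  "correct_answer P G ans =
     (case ans of None \<Rightarrow> \<not> (\<exists>D. P G D) | Some D \<Rightarrow> minimum_set P G D)"

text \<open>
  One program solves the problem of finding a minimum-size set with property \<open>P\<close> on all
  graphs of the class \<open>\<G>\<close>. The words hold numbers up to a fixed power of \<open>n + 2\<close>, that is,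
  they have \<open>O(log n)\<close> bits. The behaviour outside of the class is arbitrary.
\<close>

definition minimum_set_solvable_in_time ::
  "(nat graph \<Rightarrow> nat set \<Rightarrow> bool) \<Rightarrow> (nat graph \<Rightarrow> bool) \<Rightarrow> (nat \<Rightarrow> real) \<Rightarrow> bool" where
  "minimum_set_solvable_in_time P \<G> f \<longleftrightarrow>
     (\<exists>(prog :: com) (k :: nat) (T :: nat \<Rightarrow> nat).
        (\<lambda>n. real (T n)) \<in> O(f) \<and>
        (\<forall>n G. simple_graph G \<and> verts G = {..<n} \<and> \<G> G \<longrightarrow>
           (\<exists>t s. exec ((n + 2) ^ k) prog (input_state G n) t s \<and> t \<le> T n \<and>
                  correct_answer P G (decode_output n s))))"

end

theory Submission
  imports Defs "HOL-Real_Asymp.Real_Asymp"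
begin

text \<open>
  Let \<open>w\<close> be a vertex of maximum degree of an \<open>H\<close>-free split graph with an edge. After possibly
  moving \<open>w\<close> into the clique \<open>K\<close>, the set \<open>P\<close> of the vertices other than \<open>w\<close> that are not adjacent
  to \<open>w\<close> is independent. Since \<open>w\<close> has maximum degree and there is no induced \<open>H\<close>, every vertex
  of \<open>K\<close> has at most one neighbour in \<open>P\<close>, so every dominating set \<open>D\<close> has at least \<open>|P|\<close> elements.
  If \<open>|D| = |P|\<close>, then each element of \<open>D\<close> dominates exactly one vertex of \<open>P\<close>; the neighbourhoods
  of two of them in \<open>N(w)\<close> outside of \<open>K\<close> are nested, again because there is no induced \<open>H\<close>, and
  the largest one would have to contain all of them, which contradicts the choice of \<open>w\<close>.
  Hence the domination number is \<open>|P| + 1\<close>. It is attained by \<open>V - N(w)\<close>, and also by \<open>w\<close> together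
  with one neighbour of each vertex of \<open>P\<close>. The latter set lies in \<open>K\<close>, so it is connected, and it
  is total if \<open>P\<close> is nonempty; if \<open>P\<close> is empty, one adds a neighbour of \<open>w\<close>.
  In particular no partition into a clique and an independent set has to be computed.
\<close>

section \<open>The domination number of \<open>H\<close>-free split graphs\<close>

definition nbrs :: "'a graph \<Rightarrow> 'a \<Rightarrow> 'a set" where
  "nbrs G v = {u. adj G v u}"

definition split_partition :: "'a graph \<Rightarrow> 'a set \<Rightarrow> 'a set \<Rightarrow> bool" where
  "split_partition G K I \<longleftrightarrow>
     K \<union> I = verts G \<and> K \<inter> I = {} \<and> clique G K \<and> independent_set G I"

lemma adj_sym: "adj G u v \<longleftrightarrow> adj G v u"
  by (simp add: adj_def insert_commute)

lemma adj_symD: "adj G u v \<Longrightarrow> adj G v u"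
  by (simp add: adj_sym)

lemma adj_verts: "simple_graph G \<Longrightarrow> adj G u v \<Longrightarrow> u \<in> verts G \<and> v \<in> verts G \<and> u \<noteq> v"
  by (auto simp: simple_graph_def adj_def)

lemma nbrs_subset: "simple_graph G \<Longrightarrow> nbrs G v \<subseteq> verts G - {v}"
  using adj_verts by (fastforce simp: nbrs_def)

lemma finite_nbrs: "simple_graph G \<Longrightarrow> finite (nbrs G v)"
  using nbrs_subset[of G v] by (auto simp: simple_graph_def intro: finite_subset)

text \<open>The only form in which \<open>H_graph\<close>-freeness enters the argument. The clique
  gives the central edge, and independence of \<open>I\<close> rules out edges among the four
  leaves, so the six vertices would induce \<open>H_graph\<close>.\<close>

lemma induced_free_H_graphD:
  assumes G: "simple_graph G" and free: "induced_free H_graph G" and part: "split_partition G K I"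
    and b: "b \<in> K" "c \<in> K" "b \<noteq> c"
    and x: "x \<in> I" "y \<in> I" "x \<noteq> y" "adj G b x" "adj G b y" "\<not> adj G c x" "\<not> adj G c y"
    and z: "z \<in> I" "t \<in> I" "z \<noteq> t" "adj G c z" "adj G c t" "\<not> adj G b z" "\<not> adj G b t"
  shows False
proof -
  have bc: "adj G b c" "adj G c b"
    using part b by (auto simp: split_partition_def clique_def)
  have ind: "\<not> adj G p q" if "p \<in> I" "q \<in> I" for p q
    using part that by (auto simp: split_partition_def independent_set_def)
  have irr: "\<not> adj G p p" for p using adj_verts[OF G] by blast
  have KI: "K \<inter> I = {}" "K \<union> I = verts G" using part by (auto simp: split_partition_def)
  have ne: "b \<noteq> x" "b \<noteq> y" "b \<noteq> z" "b \<noteq> t" "c \<noteq> x" "c \<noteq> y" "c \<noteq> z" "c \<noteq> t"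
    "x \<noteq> z" "x \<noteq> t" "y \<noteq> z" "y \<noteq> t"
    using KI b x z by auto
  define f where "f = (\<lambda>v. if v = b then C1 else if v = c then C2 else if v = x then X1
    else if v = y then Y1 else if v = z then X2 else Y2)"
  define S where "S = {b, c, x, y, z, t}"
  have f: "f b = C1" "f c = C2" "f x = X1" "f y = Y1" "f z = X2" "f t = Y2"
    using ne b x z by (auto simp: f_def)
  have "bij_betw f S (verts H_graph)"
    by (auto simp: bij_betw_def inj_on_def S_def H_graph_def f)
  moreover have adjS: "adj (induced_subgraph G S) u v \<longleftrightarrow> adj G u v" if "u \<in> S" "v \<in> S" for u v
    using that by (auto simp: adj_def induced_subgraph_def)
  note adjs = bc(1) x(4,5) z(4,5)
  note nadjs = x(6,7) z(6,7) ind[OF x(1) x(2)] ind[OF x(1) z(1)] ind[OF x(1) z(2)]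
    ind[OF x(2) z(1)] ind[OF x(2) z(2)] ind[OF z(1) z(2)]
  note adjs' = adjs[THEN adj_symD]
  have nadjs': "\<not> adj G v u" if "\<not> adj G u v" for u v by (metis that adj_symD)
  note nadjs' = nadjs[THEN nadjs']
  have Hadj: "adj H_graph u v \<longleftrightarrow> (u, v) \<in> {(C1, C2), (C1, X1), (C1, Y1), (C2, X2), (C2, Y2),
    (C2, C1), (X1, C1), (Y1, C1), (X2, C2), (Y2, C2)}" for u v
    by (cases u; cases v) (simp_all add: adj_def H_graph_def doubleton_eq_iff)
  have "\<forall>u\<in>S. \<forall>v\<in>S. adj (induced_subgraph G S) u v \<longleftrightarrow> adj H_graph (f u) (f v)"
  proof (intro ballI)
    fix u v assume uv: "u \<in> S" "v \<in> S"
    \<comment> \<open>All 36 ordered pairs are decided by rewriting, which is why each edge and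
      non-edge was collected in both directions.\<close>
    have "adj G u v \<longleftrightarrow> adj H_graph (f u) (f v)"
      using uv unfolding S_def insert_iff empty_iff simp_thms
      by (elim disjE; hypsubst; simp only: f irr adjs adjs' nadjs nadjs' Hadj insert_iff empty_iff prod.inject hvert.distinct simp_thms)
    then show "adj (induced_subgraph G S) u v \<longleftrightarrow> adj H_graph (f u) (f v)"
      using adjS[OF uv] by simp
  qed
  ultimately have "graph_isomorphic (induced_subgraph G S) H_graph"
    unfolding graph_isomorphic_def by (auto simp: induced_subgraph_def)
  moreover have "S \<subseteq> verts G" using b x z KI by (auto simp: S_def)
  ultimately show False using free unfolding induced_free_def by blast
qed

text \<open>If \<open>w\<close> lies in \<open>I\<close>, a neighbour \<open>c\<close> of
  \<open>w\<close> sees \<open>w\<close> and the rest of \<open>K\<close>, hence has degree at least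
  \<open>card K\<close>. Maximality then forces the neighbourhood of \<open>w\<close> to be all of
  \<open>K\<close>, so \<open>w\<close> can change sides.\<close>

lemma split_partition_max_degree:
  assumes G: "simple_graph G" and split: "split_graph G"
    and max: "\<And>v. v \<in> verts G \<Longrightarrow> card (nbrs G v) \<le> card (nbrs G w)"
    and w: "nbrs G w \<noteq> {}"
  obtains K I where "split_partition G K I" "w \<in> K"
proof -
  obtain K I where part: "split_partition G K I"
    using split by (auto simp: split_graph_def split_partition_def)
  have fin: "finite K"
    using part G finite_subset[of K "verts G"] by (auto simp: split_partition_def simple_graph_def)
  obtain c where c: "adj G w c" using w by (auto simp: nbrs_def)
  then have wc: "w \<in> verts G" "c \<in> verts G" "w \<noteq> c" using adj_verts[OF G c] by auto
  show ?thesis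
  proof (cases "w \<in> K")
    case True
    then show ?thesis using part that by blast
  next
    case False
    then have wI: "w \<in> I" using wc part by (auto simp: split_partition_def)
    have sub: "nbrs G w \<subseteq> K"
      using part wI nbrs_subset[OF G, of w]
      by (fastforce simp: split_partition_def independent_set_def nbrs_def)
    then have cK: "c \<in> K" using c by (auto simp: nbrs_def)
    have "insert w (K - {c}) \<subseteq> nbrs G c"
      using part cK c by (auto simp: split_partition_def clique_def nbrs_def adj_sym)
    then have "card (insert w (K - {c})) \<le> card (nbrs G c)"
      using finite_nbrs[OF G] by (intro card_mono)
    moreover have "card (insert w (K - {c})) = card K"
      using card_Suc_Diff1[OF fin cK] fin False by simp
    ultimately have "card K \<le> card (nbrs G w)" using max[OF wc(2)] by simp
    then have eq: "nbrs G w = K" using sub fin by (metis card_seteq)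
    have "split_partition G (insert w K) (I - {w})"
    proof -
      have "adj G w v \<and> adj G v w" if "v \<in> K" for v
        using eq that adj_symD by (auto simp: nbrs_def)
      then show ?thesis
        using part wI wc by (auto simp: split_partition_def clique_def independent_set_def)
    qed
    then show ?thesis using that by blast
  qed
qed

text \<open>Otherwise \<open>b\<close> has three neighbours that are not neighbours of
  \<open>w\<close>. The degree of \<open>w\<close> is no smaller, so conversely \<open>w\<close> has
  three that \<open>b\<close> lacks, and two of them complete an induced
  \<open>H_graph\<close>.\<close>

lemma max_degree_private_neighbour:
  assumes G: "simple_graph G" and free: "induced_free H_graph G" and part: "split_partition G K I"
    and w: "w \<in> K" and b: "b \<in> K"
    and le: "card (nbrs G b) \<le> card (nbrs G w)"
    and x: "x \<in> I" "adj G b x" "\<not> adj G w x" and y: "y \<in> I" "adj G b y" "\<not> adj G w y"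
  shows "x = y"
proof (rule ccontr)
  assume "x \<noteq> y"
  have bw: "b \<noteq> w" using x by auto
  have out: "v \<in> I" if "u \<in> K" "v \<in> verts G - {u}" "\<not> adj G u v" for u v
  proof (rule ccontr)
    assume "v \<notin> I"
    then have "v \<in> K" "u \<noteq> v" using that part by (auto simp: split_partition_def)
    then show False using that part by (simp add: split_partition_def clique_def)
  qed
  have adjbw: "adj G b w" "adj G w b" using part bw w b by (auto simp: split_partition_def clique_def)
  let ?B = "nbrs G b" and ?W = "nbrs G w"
  have fin: "finite ?B" "finite ?W" using finite_nbrs[OF G] by auto
  \<comment> \<open>\<open>w\<close> itself is the third vertex: it is adjacent to \<open>b\<close>
    but not to itself.\<close>
  have "{w, x, y} \<subseteq> ?B - ?W"
    using x y adjbw adj_verts[OF G] by (auto simp: nbrs_def)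
  then have "card {w, x, y} \<le> card (?B - ?W)" using fin by (intro card_mono) auto
  moreover have "card {w, x, y} = 3"
  proof -
    have "w \<noteq> x" "w \<noteq> y" using x y w part by (auto simp: split_partition_def)
    then show ?thesis using \<open>x \<noteq> y\<close> by simp
  qed
  ultimately have "3 \<le> card (?B - ?W)" by simp
  also have "\<dots> \<le> card (?W - ?B)"
    using le fin card_le_sym_Diff[of ?B ?W] by simp
  \<comment> \<open>\<open>b\<close> lies in \<open>?W - ?B\<close> and has to be discarded; any
    other vertex there is a non-neighbour of \<open>b\<close> and so in \<open>I\<close> by
    \<open>out\<close>.\<close>
  finally have "2 \<le> card (?W - ?B) - card {b}" by simp
  also have "\<dots> \<le> card (?W - ?B - {b})" by (rule diff_card_le_card_Diff) simp
  finally have "2 \<le> card (?W - ?B - {b})" .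
  then obtain z t where zt: "{z, t} \<subseteq> ?W - ?B - {b}" "z \<noteq> t"
    by (metis obtain_subset_with_card_n card_2_iff)
  then have "z \<in> I" "t \<in> I"
    using out[OF b] nbrs_subset[OF G, of w] by (auto simp: nbrs_def)
  then show False
    using induced_free_H_graphD[OF G free part b w bw x(1) y(1) \<open>x \<noteq> y\<close> x(2) y(2) x(3) y(3)]
      zt by (auto simp: nbrs_def)
qed

text \<open>With \<open>P\<close> as below, the left side is \<open>card P + 1\<close>. An injection
  of \<open>P\<close> into \<open>D\<close> gives all but one; equality of \<open>card D\<close> and
  \<open>card P\<close> is refuted by a chosen dominator with a largest trace on the neighbourhood
  of \<open>w\<close>.\<close>

lemma domination_lower_bound:
  assumes split: "split_graph G" and free: "induced_free H_graph G" and w: "w \<in> verts G"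
    and max: "\<And>v. v \<in> verts G \<Longrightarrow> card (nbrs G v) \<le> card (nbrs G w)"
    and D: "dominating_set G D"
  shows "card (verts G - nbrs G w) \<le> card D"
proof -
  have G: "simple_graph G" using split by (simp add: split_graph_def)
  have finV: "finite (verts G)" using G by (simp add: simple_graph_def)
  have DV: "D \<subseteq> verts G" using D by (simp add: dominating_set_def)
  have finD: "finite D" using DV finV finite_subset by blast
  show ?thesis
  proof (cases "nbrs G w = {}")
    case True
    \<comment> \<open>If the maximum degree is 0, every vertex is isolated and belongs to
      \<open>D\<close>.\<close>
    then have "nbrs G v = {}" if "v \<in> verts G" for v
      using max[OF that] finite_nbrs[OF G, of v] by simp
    then have "verts G \<subseteq> D" using D by (auto simp: dominating_set_def nbrs_def)
    then show ?thesis using card_mono[OF finD] by (meson Diff_subset order_trans)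
  next
    case False
    obtain K I where part: "split_partition G K I" and wK: "w \<in> K"
      using split_partition_max_degree[OF G split max False] by blast
    note pd = part[unfolded split_partition_def clique_def independent_set_def]
    define P where "P = verts G - nbrs G w - {w}"
    have PI: "P \<subseteq> I" 
    proof
      fix v assume v: "v \<in> P"
      show "v \<in> I"
      proof (rule ccontr)
        assume "v \<notin> I"
        then have "v \<in> K" "v \<noteq> w" "\<not> adj G w v" using v pd by (auto simp: P_def nbrs_def)
        then show False using pd wK by simp
      qed
    qed
    have finP: "finite P" using finV by (simp add: P_def)
    have cardP: "card (verts G - nbrs G w) = Suc (card P)"
      using w nbrs_subset[OF G, of w] finV unfolding P_def
      by (metis Diff_iff card_Suc_Diff1 finite_Diff insertI1 subset_iff)
    have "\<forall>u\<in>P. \<exists>d\<in>D. d = u \<or> adj G u d"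
      using D by (auto simp: P_def dominating_set_def)
    then obtain d where d: "\<And>u. u \<in> P \<Longrightarrow> d u \<in> D" "\<And>u. u \<in> P \<Longrightarrow> d u = u \<or> adj G u (d u)"
      by metis
    \<comment> \<open>A dominator outside of \<open>K\<close> lies in \<open>I\<close> together with
      \<open>u\<close>, so it can only be \<open>u\<close> itself.\<close>
    have dI: "d u = u" if "u \<in> P" "d u \<notin> K" for u
    proof (rule ccontr)
      assume "d u \<noteq> u"
      then have "adj G u (d u)" "d u \<in> I" "u \<in> I"
        using d[OF that(1)] pd PI that DV by auto
      then show False using pd by simp
    qed
    have dK: "adj G (d u) u" if "u \<in> P" "d u \<in> K" for u
    proof -
      have "d u \<noteq> u" using that PI pd by auto
      then show ?thesis using d(2)[OF that(1)] by (simp add: adj_sym)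
    qed
    have uniq: "u = v" if "b \<in> K" "u \<in> P" "v \<in> P" "adj G b u" "adj G b v" for b u v
      using max_degree_private_neighbour[OF G free part wK that(1) max] that PI pd
      by (auto simp: P_def nbrs_def)
    \<comment> \<open>Dominators outside of \<open>K\<close> determine their vertex by
      \<open>dI\<close>, those inside by \<open>uniq\<close>.\<close>
    have inj: "inj_on d P"
    proof (rule inj_onI)
      fix u v assume uv: "u \<in> P" "v \<in> P" "d u = d v"
      then show "u = v"
        by (cases "d u \<in> K") (metis dI dK uniq)+
    qed
    show ?thesis
    proof (rule ccontr)
      assume "\<not> ?thesis"
      then have "card D \<le> card (d ` P)" using cardP card_image[OF inj] by simp
      then have DP: "D = d ` P" using d(1) finD by (metis card_seteq image_subsetI)
      \<comment> \<open>\<open>D\<close> is now exactly the image of \<open>P\<close> under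
        \<open>d\<close>. Its elements outside of \<open>K\<close> lie in \<open>P\<close>, so
        dominating \<open>w\<close> and the rest of \<open>I\<close> is left to the vertices
        \<open>d u\<close> with \<open>u\<close> in \<open>Q\<close>.\<close>
      define Q where "Q = {u \<in> P. d u \<in> K}"
      have finQ: "finite Q" using finP by (simp add: Q_def)
      have dw: "d u \<noteq> w" if "u \<in> P" for u
        using dK[OF that] that wK unfolding P_def nbrs_def by auto
      have cov: "\<exists>u\<in>Q. adj G (d u) x" if x: "x \<in> verts G - P" "x = w \<or> x \<in> I" for x
      proof -
        obtain e where e: "e \<in> D" "e = x \<or> adj G x e"
          using D x by (auto simp: dominating_set_def)
        then obtain u where u: "u \<in> P" "e = d u" using DP by auto
        have ex: "e \<noteq> x"
        proof
          assume "e = x"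
          then have "d u \<notin> K" using x u dw pd by auto
          then show False using dI[OF u(1)] u x \<open>e = x\<close> by auto
        qed
        have "e \<in> K"
        proof (rule ccontr)
          assume "e \<notin> K"
          then have "e = u" using dI u by simp
          then show False using e ex u PI x pd by (auto simp: P_def nbrs_def)
        qed
        then show ?thesis using u e ex by (auto simp: Q_def adj_sym)
      qed
      have "w \<in> verts G - P" using w by (simp add: P_def)
      then have "Q \<noteq> {}" using cov by blast
      \<comment> \<open>The trace of \<open>d u\<close>: its neighbours in \<open>I\<close> among
        those of \<open>w\<close>. A vertex \<open>u\<close> with a largest trace leads to the
        contradiction.\<close>
      define tr where "tr u = nbrs G (d u) \<inter> I \<inter> nbrs G w" for u
      obtain u where uQ: "u \<in> Q" and umax: "\<And>v. v \<in> Q \<Longrightarrow> card (tr v) \<le> card (tr u)"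
      proof -
        let ?c = "\<lambda>v. card (tr v)"
        have "Max (?c ` Q) \<in> ?c ` Q" using \<open>Q \<noteq> {}\<close> finQ by simp
        then obtain u where "u \<in> Q" "?c u = Max (?c ` Q)" by auto
        moreover have "?c v \<le> Max (?c ` Q)" if "v \<in> Q" for v using that finQ by simp
        ultimately show ?thesis using that by metis
      qed
      have fintr: "finite (tr v)" for v using finite_nbrs[OF G] by (simp add: tr_def)
      let ?b = "d u"
      have bK: "?b \<in> K" and uP: "u \<in> P" using uQ by (auto simp: Q_def)
      have bu: "adj G ?b u" using dK[OF uP bK] .
      have bw: "?b \<noteq> w" using dw[OF uP] .
      \<comment> \<open>\<open>w\<close> and \<open>u\<close> are neighbours of \<open>?b\<close>
        but not of \<open>w\<close>, so at least two neighbours of \<open>w\<close> are not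
        neighbours of \<open>?b\<close>. One is \<open>?b\<close> itself, and the other cannot be in
        \<open>K\<close>.\<close>
      obtain x where x: "x \<in> I" "adj G w x" "\<not> adj G ?b x"
      proof -
        let ?B = "nbrs G ?b" and ?W = "nbrs G w"
        have fin: "finite ?B" "finite ?W" using finite_nbrs[OF G] by auto
        have adjbw: "adj G ?b w" "adj G w ?b" using pd bw wK bK by auto
        have "{w, u} \<subseteq> ?B - ?W"
          using bu adjbw uP adj_verts[OF G] by (auto simp: nbrs_def P_def)
        then have "card {w, u} \<le> card (?B - ?W)" using fin by (intro card_mono) auto
        moreover have "card {w, u} = 2" using uP by (auto simp: P_def)
        ultimately have "2 \<le> card (?B - ?W)" by simp
        also have "\<dots> \<le> card (?W - ?B)"
          using max[of ?b] bK pd fin card_le_sym_Diff[of ?B ?W] by auto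
        finally have "1 \<le> card (?W - ?B) - card {?b}" by simp
        also have "\<dots> \<le> card (?W - ?B - {?b})" by (rule diff_card_le_card_Diff) simp
        finally have "?W - ?B - {?b} \<noteq> {}" by fastforce
        then obtain x where "x \<in> ?W - ?B - {?b}" by blast
        then have x: "adj G w x" "\<not> adj G ?b x" "?b \<noteq> x" by (auto simp: nbrs_def)
        have "x \<notin> K" using x bK pd by auto
        then have "x \<in> I" using adj_verts[OF G x(1)] pd by auto
        then show ?thesis using that x by blast
      qed
      then have "x \<in> verts G - P" using pd by (auto simp: P_def nbrs_def)
      then obtain v where v: "v \<in> Q" "adj G (d v) x" using cov x by blast
      let ?c = "d v"
      have cK: "?c \<in> K" and vP: "v \<in> P" using v by (auto simp: Q_def)
      have cv: "adj G ?c v" using dK[OF vP cK] .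
      have bc: "?b \<noteq> ?c" using v x by auto
      then have uv: "u \<noteq> v" by auto
      \<comment> \<open>A vertex \<open>y\<close> violating the inclusion yields an induced
        \<open>H_graph\<close> with leaves \<open>u\<close>, \<open>y\<close> at \<open>?b\<close>
        and \<open>v\<close>, \<open>x\<close> at \<open>?c\<close>. As \<open>x\<close> lies only
        in \<open>tr v\<close>, the inclusion is strict, against the choice of
        \<open>u\<close>.\<close>
      have nested: "tr u \<subseteq> tr v"
      proof
        fix y assume y: "y \<in> tr u"
        show "y \<in> tr v"
        proof (rule ccontr)
          assume "y \<notin> tr v"
          then have y': "y \<in> I" "adj G ?b y" "\<not> adj G ?c y" "adj G w y"
            using y by (auto simp: tr_def nbrs_def)
          have "u \<noteq> y" "v \<noteq> x" using y' x uP vP by (auto simp: P_def nbrs_def)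
          moreover have "\<not> adj G ?c u" "\<not> adj G ?b v"
            using uniq[OF cK uP vP _ cv] uniq[OF bK uP vP bu] uv by auto
          ultimately show False
            using induced_free_H_graphD[OF G free part bK cK bc, of u y v x]
              uP vP PI y' x bu cv v(2) by blast
        qed
      qed
      have "x \<in> tr v" "x \<notin> tr u" using x v by (auto simp: tr_def nbrs_def)
      then have "card (tr u) < card (tr v)"
        using nested fintr by (metis psubsetI psubset_card_mono)
      then show False using umax[OF v(1)] by simp
    qed
  qed
qed

section \<open>General facts on total and connected domination\<close>

lemma total_dominating_imp_dominating: "total_dominating_set G D \<Longrightarrow> dominating_set G D"
  by (auto simp: total_dominating_set_def dominating_set_def)

lemma total_dominating_card_ge_2:
  assumes G: "simple_graph G" and V: "verts G \<noteq> {}" and D: "total_dominating_set G D"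
  shows "2 \<le> card D"
proof -
  have fin: "finite D"
    using D G by (auto simp: total_dominating_set_def simple_graph_def intro: finite_subset)
  obtain u where u: "u \<in> D" using V D by (auto simp: total_dominating_set_def)
  then obtain v where v: "v \<in> D" "adj G u v" using D by (auto simp: total_dominating_set_def)
  have "u \<noteq> v" using adj_verts[OF G v(2)] by simp
  then have "card {u, v} = 2" by simp
  then show ?thesis using card_mono[OF fin, of "{u, v}"] u v by simp
qed

lemma connected_graph_cliqueI:
  assumes "\<And>u v. u \<in> D \<Longrightarrow> v \<in> D \<Longrightarrow> u \<noteq> v \<Longrightarrow> adj G u v"
  shows "connected_graph (induced_subgraph G D)"
  unfolding connected_graph_def
proof (intro ballI)
  fix u v assume "u \<in> verts (induced_subgraph G D)" "v \<in> verts (induced_subgraph G D)"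
  then have "u = v \<or> adj (induced_subgraph G D) u v"
    using assms[of u v] by (auto simp: induced_subgraph_def adj_def)
  then show "(u, v) \<in> {(x, y). adj (induced_subgraph G D) x y}\<^sup>*" by auto
qed

text \<open>\<open>D\<close> must contain the isolated \<open>u\<close> and also a different vertex
  covering \<open>w\<close>; a walk between them would leave \<open>u\<close> along an edge.\<close>

lemma isolated_no_connected_dominating_set:
  assumes w: "w \<in> verts G" and u: "u \<in> verts G" "u \<noteq> w" "nbrs G u = {}"
  shows "\<not> connected_dominating_set G D"
proof
  assume cds: "connected_dominating_set G D"
  then have dom: "dominating_set G D" and con: "connected_graph (induced_subgraph G D)"
    by (auto simp: connected_dominating_set_def)
  have uD: "u \<in> D" using dom u by (auto simp: dominating_set_def nbrs_def)
  obtain v where v: "v \<in> D" "v = w \<or> adj G w v"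
    using dom w by (auto simp: dominating_set_def)
  have "v \<noteq> u" using v u adj_sym[of G w u] by (auto simp: nbrs_def)
  moreover have "(u, v) \<in> {(x, y). adj (induced_subgraph G D) x y}\<^sup>*"
    using con uD v by (auto simp: connected_graph_def induced_subgraph_def)
  ultimately obtain x where "adj (induced_subgraph G D) u x"
    by (auto elim: converse_rtranclE)
  then show False using u by (auto simp: induced_subgraph_def adj_def nbrs_def)
qed

section \<open>Optimal sets built from a vertex of maximum degree\<close>

locale max_degree_vertex =
  fixes G :: "'a graph" and w :: 'a
  assumes split: "split_graph G" and free: "induced_free H_graph G" and w: "w \<in> verts G"
    and max: "v \<in> verts G \<Longrightarrow> card (nbrs G v) \<le> card (nbrs G w)"
begin

lemma simple: "simple_graph G"
  using split by (simp add: split_graph_def)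

text \<open>This is the set \<open>P\<close> of the lower bound.\<close>

definition far :: "'a set" where
  "far = verts G - nbrs G w - {w}"

lemma finite_far: "finite far"
  using simple by (auto simp: far_def simple_graph_def)

lemma card_far: "card (verts G - nbrs G w) = Suc (card far)"
  using w nbrs_subset[OF simple, of w] simple unfolding far_def simple_graph_def
  by (metis Diff_iff card_Suc_Diff1 finite_Diff insertI1 subset_iff)

lemma Suc_card_far_le: "dominating_set G D \<Longrightarrow> Suc (card far) \<le> card D"
  using domination_lower_bound[OF split free w max] card_far by simp

lemma minimum_dominating_set: "minimum_set dominating_set G (verts G - nbrs G w)"
proof -
  have "w \<in> verts G - nbrs G w" using w nbrs_subset[OF simple, of w] by auto
  then have "dominating_set G (verts G - nbrs G w)"
    by (auto simp: dominating_set_def nbrs_def adj_sym)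
  then show ?thesis
    using domination_lower_bound[OF split free w max] by (simp add: minimum_set_def)
qed

lemma card_insert_image_far: "card (insert w (f ` far)) \<le> Suc (card far)"
  using finite_far card_image_le[OF finite_far, of f] by (simp add: card_insert_if le_SucI)

text \<open>Distinct \<open>a\<close> and \<open>b\<close> make \<open>far\<close> nonempty, so the
  maximum degree is positive and \<open>w\<close> can be taken in \<open>K\<close>. Then
  \<open>far\<close> lies in \<open>I\<close>, and the neighbours of its vertices lie in
  \<open>K\<close>.\<close>

lemma clique_insert_image_far:
  assumes f: "\<And>u. u \<in> far \<Longrightarrow> adj G u (f u)"
    and D: "a \<in> insert w (f ` far)" "b \<in> insert w (f ` far)" "a \<noteq> b"
  shows "adj G a b"
proof -
  have "far \<noteq> {}" using D by auto
  then obtain u where u: "u \<in> far" by blast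
  then have "nbrs G (f u) \<noteq> {}" using f[OF u] by (auto simp: nbrs_def adj_sym)
  moreover have "f u \<in> verts G" using adj_verts[OF simple f[OF u]] by simp
  ultimately have "0 < card (nbrs G w)"
    using max[of "f u"] finite_nbrs[OF simple, of "f u"] by (metis card_gt_0_iff less_le_trans)
  then have "nbrs G w \<noteq> {}" by auto
  then obtain K I where part: "split_partition G K I" and wK: "w \<in> K"
    using split_partition_max_degree[OF simple split max] by blast
  have "f x \<in> K" if x: "x \<in> far" for x
  proof -
    have "x \<notin> K"
      using x wK part by (auto simp: far_def nbrs_def split_partition_def clique_def)
    then have "x \<in> I" using x part by (auto simp: far_def split_partition_def)
    then have "f x \<notin> I" using f[OF x] part by (auto simp: split_partition_def independent_set_def)
    then show ?thesis using adj_verts[OF simple f[OF x]] part by (auto simp: split_partition_def)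
  qed
  then have "a \<in> K" "b \<in> K" using D wK by auto
  then show ?thesis using D(3) part by (simp add: split_partition_def clique_def)
qed

lemma dominating_insert_image_far:
  assumes f: "\<And>u. u \<in> far \<Longrightarrow> adj G u (f u)"
  shows "dominating_set G (insert w (f ` far))"
  unfolding dominating_set_def
proof (intro conjI ballI)
  show "insert w (f ` far) \<subseteq> verts G" using w adj_verts[OF simple f] by auto
next
  fix v assume "v \<in> verts G"
  then consider "v = w" | "v \<in> far" | "adj G v w"
    by (auto simp: far_def nbrs_def adj_sym)
  then show "v \<in> insert w (f ` far) \<or> (\<exists>u\<in>insert w (f ` far). adj G v u)"
    by cases (use f in auto)
qed

lemma minimum_connected_dominating_set:
  assumes f: "\<And>u. u \<in> far \<Longrightarrow> adj G u (f u)"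
  shows "minimum_set connected_dominating_set G (insert w (f ` far))"
proof -
  have "connected_graph (induced_subgraph G (insert w (f ` far)))"
    using clique_insert_image_far[OF f] by (rule connected_graph_cliqueI)
  moreover have "card (insert w (f ` far)) \<le> card D" if "connected_dominating_set G D" for D
    using that Suc_card_far_le[of D] card_insert_image_far[of f]
    by (simp add: connected_dominating_set_def)
  ultimately show ?thesis
    using dominating_insert_image_far[OF f]
    by (simp add: minimum_set_def connected_dominating_set_def)
qed

lemma no_connected_dominating_set:
  assumes "u \<in> far" "nbrs G u = {}"
  shows "\<not> connected_dominating_set G D"
proof (rule isolated_no_connected_dominating_set[OF w])
  show "u \<in> verts G" "u \<noteq> w" using assms(1) by (simp_all add: far_def)
qed (rule assms(2))

text \<open>The vertices for which a neighbour is chosen in the total case. If \<open>w\<close> is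
  adjacent to all others, only \<open>w\<close> itself lacks a neighbour in
  \<open>{w}\<close>.\<close>

definition far' :: "'a set" where
  "far' = (if far = {} then {w} else far)"

lemma minimum_total_dominating_set:
  assumes f: "\<And>u. u \<in> far' \<Longrightarrow> adj G u (f u)"
  shows "minimum_set total_dominating_set G (insert w (f ` far'))"
proof (cases "far = {}")
  case True
  then have far': "far' = {w}" by (simp add: far'_def)
  have fw: "adj G w (f w)" using f far' by simp
  have "adj G v w" if "v \<in> verts G" "v \<noteq> w" for v
    using that True by (auto simp: far_def nbrs_def adj_sym)
  then have "total_dominating_set G {w, f w}"
    using fw w adj_verts[OF simple fw] unfolding total_dominating_set_def by blast
  moreover have "card {w, f w} \<le> 2" by (simp add: card_insert_if)
  ultimately show ?thesis
    using total_dominating_card_ge_2[OF simple] w far'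
    by (fastforce simp: minimum_set_def)
next
  case False
  then have far': "far' = far" by (simp add: far'_def)
  then have f: "adj G u (f u)" if "u \<in> far" for u using f that by simp
  let ?D = "insert w (f ` far)"
  have dom: "dominating_set G ?D" using dominating_insert_image_far[OF f] .
  obtain u where u: "u \<in> far" using False by blast
  \<comment> \<open>Hence \<open>?D\<close> is a clique with at least two vertices, and its members
    dominate each other.\<close>
  have fu: "f u \<noteq> w" using f[OF u] u by (auto simp: far_def nbrs_def adj_sym)
  have "\<exists>d\<in>?D. adj G v d" if v: "v \<in> verts G" for v
  proof (cases "v \<in> ?D")
    case True
    obtain d where "d \<in> ?D" "v \<noteq> d" using fu u by (cases "v = w") auto
    then show ?thesis using clique_insert_image_far[OF f True] by blast
  next
    case False
    then show ?thesis using dom v by (auto simp: dominating_set_def)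
  qed
  then have "total_dominating_set G ?D" using dom by (simp add: total_dominating_set_def dominating_set_def)
  moreover have "card ?D \<le> card D" if "total_dominating_set G D" for D
    using Suc_card_far_le[OF total_dominating_imp_dominating[OF that]] card_insert_image_far[of f]
    by simp
  ultimately show ?thesis by (simp add: minimum_set_def far')
qed

lemma no_total_dominating_set:
  assumes "u \<in> far'" "nbrs G u = {}"
  shows "\<not> total_dominating_set G D"
proof -
  have "u \<in> verts G" using assms(1) w by (auto simp: far'_def far_def split: if_splits)
  moreover have "\<not> adj G u d" for d using assms(2) by (simp add: nbrs_def)
  ultimately show ?thesis by (simp add: total_dominating_set_def) blast
qed

text \<open>Lets a program detect the exceptional case by comparing a degree with
  \<open>n\<close>.\<close>

lemma far_eq_empty_iff: "far = {} \<longleftrightarrow> card (verts G) \<le> Suc (card (nbrs G w))"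
proof -
  have "card (verts G - nbrs G w) = card (verts G) - card (nbrs G w)"
    using nbrs_subset[OF simple, of w] finite_nbrs[OF simple] by (intro card_Diff_subset) auto
  moreover have "far = {} \<longleftrightarrow> card far = 0" using finite_far by simp
  ultimately show ?thesis using card_far by linarith
qed

end

section \<open>Weakest preconditions with a syntactic time bound\<close>

text \<open>Sums both branches of a conditional and counts \<open>n\<close> iterations for every loop.\<close>

fun cost :: "nat \<Rightarrow> com \<Rightarrow> nat" where
  "cost n (Seq c d) = cost n c + cost n d"
| "cost n (IfLess i j c d) = 1 + cost n c + cost n d"
| "cost n (WhileLess i j c) = n * (1 + cost n c) + 1"
| "cost n _ = 1"

text \<open>An execution exists only if no result leaves the word range, so this covers termination,
  absence of overflow, running time and the final state at once.\<close>

definition wp :: "nat \<Rightarrow> nat \<Rightarrow> com \<Rightarrow> (ram_state \<Rightarrow> bool) \<Rightarrow> ram_state \<Rightarrow> bool" where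
  "wp B n c Q s \<longleftrightarrow> (\<exists>t s'. exec B c s t s' \<and> t \<le> cost n c \<and> Q s')"

lemma wp_Skip: "Q s \<Longrightarrow> wp B n Skip Q s"
  unfolding wp_def by (fastforce intro: exec.intros)

lemma wp_LoadConst: "x < B \<Longrightarrow> Q (set_reg r x s) \<Longrightarrow> wp B n (LoadConst r x) Q s"
  unfolding wp_def by (fastforce intro: exec.intros)

lemma wp_Add:
  "reg s i + reg s j < B \<Longrightarrow> Q (set_reg r (reg s i + reg s j) s) \<Longrightarrow> wp B n (Add r i j) Q s"
  unfolding wp_def by (fastforce intro: exec.intros)

lemma wp_Sub:
  "reg s i - reg s j < B \<Longrightarrow> Q (set_reg r (reg s i - reg s j) s) \<Longrightarrow> wp B n (Sub r i j) Q s"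
  unfolding wp_def by (fastforce intro: exec.intros)

lemma wp_Mul:
  "reg s i * reg s j < B \<Longrightarrow> Q (set_reg r (reg s i * reg s j) s) \<Longrightarrow> wp B n (Mul r i j) Q s"
  unfolding wp_def by (fastforce intro: exec.intros)

lemma wp_Load:
  "mem s (reg s a) < B \<Longrightarrow> Q (set_reg r (mem s (reg s a)) s) \<Longrightarrow> wp B n (Load r a) Q s"
  unfolding wp_def by (fastforce intro: exec.intros)

lemma wp_Store:
  "reg s r < B \<Longrightarrow> Q (s\<lparr>mem := (mem s)(reg s a := reg s r)\<rparr>) \<Longrightarrow> wp B n (Store a r) Q s"
  unfolding wp_def by (fastforce intro: exec.intros)

lemma wp_Seq: "wp B n c (wp B n d Q) s \<Longrightarrow> wp B n (Seq c d) Q s"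
  unfolding wp_def by (fastforce intro: exec.intros add_mono)

lemma wp_IfLess:
  assumes "reg s i < reg s j \<Longrightarrow> wp B n c Q s" and "\<not> reg s i < reg s j \<Longrightarrow> wp B n d Q s"
  shows "wp B n (IfLess i j c d) Q s"
proof (cases "reg s i < reg s j")
  case True
  then obtain t s' where "exec B c s t s'" "t \<le> cost n c" "Q s'"
    using assms by (auto simp: wp_def)
  then show ?thesis
    using exec.IfTrue[of s i j B c t s' d] True by (fastforce simp: wp_def)
next
  case False
  then obtain t s' where "exec B d s t s'" "t \<le> cost n d" "Q s'"
    using assms by (auto simp: wp_def)
  then show ?thesis
    using exec.IfFalse[of s i j B d t s' c] False by (fastforce simp: wp_def)
qed

lemma wp_mono: "wp B n c P s \<Longrightarrow> (\<And>s. P s \<Longrightarrow> Q s) \<Longrightarrow> wp B n c Q s"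
  unfolding wp_def by blast

text \<open>Every loop of the programs counts a register from 0 up to \<open>n\<close>. Indexing the
  invariant by the counter yields both termination and the \<open>n\<close> iterations charged by
  \<open>cost\<close>.\<close>

lemma wp_for:
  assumes start: "Inv 0 s"
    and counter: "\<And>k s. Inv k s \<Longrightarrow> reg s i = k \<and> reg s j = n"
    and step: "\<And>k s. k < n \<Longrightarrow> Inv k s \<Longrightarrow> wp B n c (Inv (Suc k)) s"
    and final: "\<And>s. Inv n s \<Longrightarrow> Q s"
  shows "wp B n (WhileLess i j c) Q s"
proof -
  \<comment> \<open>Generalised to an arbitrary start \<open>k\<close>, for induction on the
    remaining iterations; the final 1 pays for the failing test.\<close>
  have "\<exists>t s'. exec B (WhileLess i j c) s t s' \<and> t \<le> (n - k) * (1 + cost n c) + 1 \<and> Inv n s'"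
    if "Inv k s" "k \<le> n" for k s
    using that
  proof (induction "n - k" arbitrary: k s)
    case 0
    then show ?case
      using counter[of k s] exec.WhileFalse[of s i j B c] by fastforce
  next
    case (Suc m)
    then have k: "k < n" by simp
    obtain t1 s1 where s1: "exec B c s t1 s1" "t1 \<le> cost n c" "Inv (Suc k) s1"
      using step[OF k Suc.prems(1)] by (auto simp: wp_def)
    obtain t2 s2 where s2: "exec B (WhileLess i j c) s1 t2 s2"
      "t2 \<le> (n - Suc k) * (1 + cost n c) + 1" "Inv n s2"
      using Suc.hyps(1)[OF _ s1(3) Suc_leI[OF k]] Suc.hyps(2) by (metis Suc_diff_Suc k nat.inject)
    have "exec B (WhileLess i j c) s (1 + t1 + t2) s2"
      using exec.WhileTrue[OF _ s1(1) s2(1)] counter[OF Suc.prems(1)] k by simp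
    moreover have "n - k = Suc (n - Suc k)" using k by simp
    then have "1 + t1 + t2 \<le> (n - k) * (1 + cost n c) + 1" using s1(2) s2(2) by simp
    ultimately show ?case using s2(3) by blast
  qed
  from this[OF start] show ?thesis using final by (fastforce simp: wp_def)
qed

lemmas wp_intros = wp_Skip wp_LoadConst wp_Add wp_Sub wp_Mul wp_Load wp_Store wp_Seq wp_IfLess

abbreviation seq (infixr ";;" 60) where "c ;; d \<equiv> Seq c d"

section \<open>The programs\<close>

text \<open>
  Registers: 0 holds \<open>n\<close> (finally the answer flag), 1 the constant 1, 2 and 3 the loop counters,
  4 the vertex \<open>w\<close>, 5 its degree, 6 a degree or a neighbour (\<open>n\<close> if none was found), 7 an
  address, 8 a value, 11 the constant 0, 12 the address \<open>n * n\<close>. Register 10 is cleared if a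
  vertex that needs a neighbour has none. Register 9 is 0 iff a neighbour of \<open>w\<close> itself
  is to be added.
\<close>

definition load_prog :: "nat \<Rightarrow> nat \<Rightarrow> com" where
  "load_prog i j = (Mul 7 i 0;; Add 7 7 j;; Load 8 7)"

definition degree_prog :: com where
  "degree_prog =
     (LoadConst 6 0;; LoadConst 3 0;;
      WhileLess 3 0 (load_prog 2 3;; Add 6 6 8;; Add 3 3 1))"

text \<open>Adding register 11, which is never written, serves as a move instruction. Registers 2,
  4, 5 and 11 are expected to be 0 initially.\<close>

definition max_degree_prog :: com where
  "max_degree_prog =
     (LoadConst 1 1;;
      WhileLess 2 0 (degree_prog;; IfLess 5 6 (Add 5 6 11;; Add 4 2 11) Skip;; Add 2 2 1))"

definition non_nbrs_prog :: com where
  "non_nbrs_prog =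
     (Mul 12 0 0;; LoadConst 3 0;;
      WhileLess 3 0 (load_prog 4 3;; Sub 8 1 8;; Add 7 12 3;; Store 7 8;; Add 3 3 1);;
      LoadConst 0 1)"

text \<open>Leaves 0 in register 8 exactly if the current vertex needs a neighbour. Two strict tests
  recognise \<open>w\<close>, for which register 9 replaces the matrix entry.\<close>

definition far_test_prog :: com where
  "far_test_prog = (load_prog 4 2;; IfLess 2 4 Skip (IfLess 4 2 Skip (Add 8 9 11)))"

definition find_nbr_prog :: com where
  "find_nbr_prog =
     (Add 6 0 11;; LoadConst 3 0;;
      WhileLess 3 0 (load_prog 2 3;; IfLess 11 8 (Add 6 3 11) Skip;; Add 3 3 1))"

definition hubs_prog :: com where
  "hubs_prog =
     (Mul 12 0 0;; Add 7 12 4;; Store 7 1;; LoadConst 10 1;; LoadConst 2 0;;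
      WhileLess 2 0 (
        far_test_prog;;
        IfLess 8 1 (find_nbr_prog;; IfLess 6 0 (Add 7 12 6;; Store 7 1) (LoadConst 10 0)) Skip;;
        Add 2 2 1);;
      Add 0 10 11)"

section \<open>Verification of the programs on an abstract adjacency matrix\<close>

locale matrix_ram =
  fixes A :: "nat \<Rightarrow> nat \<Rightarrow> bool" and n B :: nat
  assumes word: "n * n + n + 2 \<le> B"
begin

definition cells :: "(nat \<Rightarrow> nat) \<Rightarrow> bool" where
  "cells m \<longleftrightarrow> (\<forall>i<n. \<forall>j<n. m (i * n + j) = of_bool (A i j))"

definition out :: "(nat \<Rightarrow> nat) \<Rightarrow> nat set" where
  "out m = {v. v < n \<and> m (n * n + v) \<noteq> 0}"

definition deg :: "nat \<Rightarrow> nat" where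
  "deg i = card {j. j < n \<and> A i j}"

text \<open>Only the scratch registers may change.\<close>

definition frame :: "ram_state \<Rightarrow> ram_state \<Rightarrow> bool" where
  "frame s s' \<longleftrightarrow> mem s' = mem s \<and> (\<forall>r. r \<notin> {3, 6, 7, 8} \<longrightarrow> reg s' r = reg s r)"

lemma frame_refl: "frame s s"
  by (simp add: frame_def)

text \<open>Rewriting form of \<open>frame\<close>: scratch register updates are peeled off one at a
  time, and the second equation drops the trivial update that remains.\<close>

lemma frame_set_reg:
  "r \<in> {3, 6, 7, 8} \<Longrightarrow> frame s (s'\<lparr>reg := f(r := x)\<rparr>) \<longleftrightarrow> frame s (s'\<lparr>reg := f\<rparr>)"
  "frame s (s'\<lparr>reg := reg s'\<rparr>) \<longleftrightarrow> frame s s'"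
proof -
  have "(f(r := x)) q = f q" if "r \<in> {3, 6, 7, 8}" "q \<notin> {3, 6, 7, 8}" for q
    using that by (metis fun_upd_other)
  then show "r \<in> {3, 6, 7, 8} \<Longrightarrow>
      frame s (s'\<lparr>reg := f(r := x)\<rparr>) \<longleftrightarrow> frame s (s'\<lparr>reg := f\<rparr>)"
    unfolding frame_def by (simp del: fun_upd_apply)
qed (simp add: frame_def)

lemma frameD:
  assumes "frame s s'"
  shows "mem s' = mem s" "reg s' 0 = reg s 0" "reg s' 1 = reg s 1" "reg s' (Suc 0) = reg s 1"
    "reg s' 2 = reg s 2" "reg s' 4 = reg s 4" "reg s' 5 = reg s 5" "reg s' 9 = reg s 9"
    "reg s' 10 = reg s 10" "reg s' 11 = reg s 11" "reg s' 12 = reg s 12"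
  using assms by (simp_all add: frame_def)

text \<open>The matrix ends before the output vector begins, so writing output keeps the matrix
  intact.\<close>

lemma cell_less: "i * n + j < n * n" if "i < n" "j < n"
proof -
  have "i * n + j < Suc i * n" using that by simp
  also have "\<dots> \<le> n * n" using that by (intro mult_right_mono) auto
  finally show ?thesis .
qed

lemma cells_upd: "cells m \<Longrightarrow> cells (m(n * n + v := x))"
  unfolding cells_def using cell_less by (metis fun_upd_other not_add_less1)

lemma out_upd: "out (m(n * n + v := Suc 0)) = {..<n} \<inter> insert v (out m)"
  by (auto simp: out_def)

lemma wp_load:
  assumes "cells (mem s)" "reg s 0 = n" "reg s i < n" "reg s j < n" "i \<noteq> 7" "j \<noteq> 7"
    and Q: "Q (set_reg 8 (of_bool (A (reg s i) (reg s j)))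
      (set_reg 7 (reg s i * n + reg s j) s))"
  shows "wp B n (load_prog i j) Q s"
proof -
  have "reg s i * n + reg s j < B" using word cell_less[OF assms(3,4)] by simp
  moreover have "of_bool (A (reg s i) (reg s j)) < B"
    using word by (auto intro: less_le_trans[of _ 2])
  moreover have "mem s (reg s i * n + reg s j) = of_bool (A (reg s i) (reg s j))"
    using assms by (simp add: cells_def)
  ultimately show ?thesis
    unfolding load_prog_def using assms(2,5,6) Q
    by (intro wp_intros) simp_all
qed

lemma count_Suc: "card {j. j < Suc k \<and> P j} = card {j. j < k \<and> P j} + of_bool (P k)"
proof -
  have "{j. j < Suc k \<and> P j} = (if P k then insert k {j. j < k \<and> P j} else {j. j < k \<and> P j})"
    by (auto simp: less_Suc_eq)
  then show ?thesis by simp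
qed

lemma count_le: "card {j. j < k \<and> P j} \<le> k"
  using card_mono[of "{..<k}" "{j. j < k \<and> P j}"] by auto

lemma wp_degree_prog:
  assumes s: "cells (mem s)" "reg s 0 = n" "reg s 1 = 1" "reg s 2 < n"
    and Q: "\<And>s'. frame s s' \<Longrightarrow> reg s' 6 = deg (reg s 2) \<Longrightarrow> Q s'"
  shows "wp B n degree_prog Q s"
proof -
  let ?k = "reg s 2"
  let ?Inv = "\<lambda>l s'. frame s s' \<and> l \<le> n \<and> reg s' 3 = l \<and> reg s' 6 = card {j. j < l \<and> A ?k j}"
  have "wp B n (WhileLess 3 0 (load_prog 2 3;; Add 6 6 8;; Add 3 3 1)) Q
    (set_reg 3 0 (set_reg 6 0 s))"
  proof (rule wp_for[where Inv = ?Inv])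
    fix l s' assume l: "l < n" and inv: "?Inv l s'"
    then have fr: "frame s s'" by simp
    have "card {j. j < l \<and> A ?k j} + of_bool (A ?k l) < B" "Suc l < B"
      using word l count_le[of l "A ?k"] by (auto intro: le_less_trans[of _ "Suc l"])
    then show "wp B n (load_prog 2 3;; Add 6 6 8;; Add 3 3 1) (?Inv (Suc l)) s'"
      using inv s l frameD[OF fr]
      by (intro wp_load wp_intros) (simp_all add: frame_set_reg count_Suc)
  qed (use s Q in \<open>auto simp: frame_refl frame_set_reg frameD deg_def\<close>)
  then show ?thesis
    unfolding degree_prog_def using word by (intro wp_Seq wp_LoadConst) auto
qed

text \<open>Loop invariant. Before the first round register 4 names no inspected vertex, hence the
  separate disjunct; afterwards it is correct even if vertex 0 has degree 0 and the strict test
  fails.\<close>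

definition degs_ok :: "nat \<Rightarrow> (nat \<Rightarrow> nat) \<Rightarrow> ram_state \<Rightarrow> bool" where
  "degs_ok k m s \<longleftrightarrow> mem s = m \<and> reg s 0 = n \<and> reg s 1 = 1 \<and> reg s 2 = k \<and> reg s 11 = 0 \<and>
     k \<le> n \<and> (k = 0 \<and> reg s 4 = 0 \<and> reg s 5 = 0 \<or> reg s 4 < k \<and> reg s 5 = deg (reg s 4)) \<and>
     (\<forall>i<k. deg i \<le> reg s 5)"

lemma wp_max_degree_prog:
  assumes s: "cells (mem s)" "\<And>r. reg s r = (if r = 0 then n else 0)"
    and Q: "\<And>s'. degs_ok n (mem s) s' \<Longrightarrow> Q s'"
  shows "wp B n max_degree_prog Q s"
proof -
  have "wp B n (WhileLess 2 0
    (degree_prog;; IfLess 5 6 (Add 5 6 11;; Add 4 2 11) Skip;; Add 2 2 1)) Q (set_reg 1 1 s)"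
  proof (rule wp_for[where Inv = "\<lambda>k. degs_ok k (mem s)"])
    fix k s' assume k: "k < n" and inv: "degs_ok k (mem s) s'"
    have "wp B n (IfLess 5 6 (Add 5 6 11;; Add 4 2 11) Skip;; Add 2 2 1) (degs_ok (Suc k) (mem s)) s''"
      if fr: "frame s' s''" and d: "reg s'' 6 = deg k" for s''
    proof -
      have "deg k < B" "Suc k < B" "k < B"
        using word k count_le[of n "A k"] by (auto simp: deg_def)
      then show ?thesis
        using inv k d frameD[OF fr]
        by (intro wp_intros)
          (auto simp: degs_ok_def less_Suc_eq intro: less_imp_le order_trans)
    qed
    then show "wp B n (degree_prog;; IfLess 5 6 (Add 5 6 11;; Add 4 2 11) Skip;; Add 2 2 1)
        (degs_ok (Suc k) (mem s)) s'"
      using inv s(1) k by (intro wp_Seq[of _ _ degree_prog] wp_degree_prog) (simp_all add: degs_ok_def)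
  qed (use s Q in \<open>auto simp: degs_ok_def\<close>)
  then show ?thesis
    unfolding max_degree_prog_def using word by (intro wp_Seq wp_LoadConst) auto
qed

lemma wp_non_nbrs_prog:
  assumes s: "cells (mem s)" "reg s 0 = n" "reg s 1 = 1" "0 < n \<Longrightarrow> reg s 4 < n"
    and Q: "\<And>s'. reg s' 0 = 1 \<Longrightarrow> out (mem s') = {v. v < n \<and> \<not> A (reg s 4) v} \<Longrightarrow> Q s'"
  shows "wp B n non_nbrs_prog Q s"
proof -
  let ?w = "reg s 4"
  let ?Inv = "\<lambda>l (s' :: ram_state). cells (mem s') \<and> reg s' 0 = n \<and> reg s' 1 = 1 \<and> reg s' 4 = ?w \<and>
    reg s' 12 = n * n \<and> reg s' 3 = l \<and> l \<le> n \<and>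
    (\<forall>v<l. mem s' (n * n + v) = 1 - of_bool (A ?w v))"
  have "wp B n (WhileLess 3 0 (load_prog 4 3;; Sub 8 1 8;; Add 7 12 3;; Store 7 8;; Add 3 3 1))
    (wp B n (LoadConst 0 1) Q) (set_reg 3 0 (set_reg 12 (n * n) s))"
  proof (rule wp_for[where Inv = ?Inv])
    fix l s' assume l: "l < n" and inv: "?Inv l s'"
    have "1 - of_bool (A ?w l) < B" "Suc l < B" "n * n + l < B"
      using word l by (auto intro: le_less_trans[of _ "1"])
    then show "wp B n (load_prog 4 3;; Sub 8 1 8;; Add 7 12 3;; Store 7 8;; Add 3 3 1)
        (?Inv (Suc l)) s'"
      using inv s l
      by (intro wp_load wp_intros) (simp_all add: cells_upd less_Suc_eq)
  next
    fix s' assume inv: "?Inv n s'"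
    show "wp B n (LoadConst 0 1) Q s'"
    proof (rule wp_LoadConst)
      show "Q (set_reg 0 1 s')"
        using inv by (intro Q) (auto simp: out_def)
    qed (use word in simp)
  qed (use s in auto)
  then show ?thesis
    unfolding non_nbrs_prog_def using word s by (intro wp_Seq wp_Mul wp_LoadConst) auto
qed

lemma wp_find_nbr_prog:
  assumes s: "cells (mem s)" "reg s 0 = n" "reg s 1 = 1" "reg s 11 = 0" "reg s 2 < n"
    and Q: "\<And>s'. frame s s' \<Longrightarrow> reg s' 6 < n \<Longrightarrow> A (reg s 2) (reg s' 6) \<Longrightarrow> Q s'"
      "\<And>s'. frame s s' \<Longrightarrow> reg s' 6 = n \<Longrightarrow> (\<forall>v<n. \<not> A (reg s 2) v) \<Longrightarrow> Q s'"
  shows "wp B n find_nbr_prog Q s"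
proof -
  let ?k = "reg s 2"
  let ?Inv = "\<lambda>l s'. frame s s' \<and> l \<le> n \<and> reg s' 3 = l \<and>
    (reg s' 6 < n \<and> A ?k (reg s' 6) \<or> reg s' 6 = n \<and> (\<forall>v<l. \<not> A ?k v))"
  have "wp B n (WhileLess 3 0 (load_prog 2 3;; IfLess 11 8 (Add 6 3 11) Skip;; Add 3 3 1)) Q
    (set_reg 3 0 (set_reg 6 n s))"
  proof (rule wp_for[where Inv = ?Inv])
    fix l s' assume l: "l < n" and inv: "?Inv l s'"
    then have fr: "frame s s'" by simp
    have "l < B" "Suc l < B" using word l by simp_all
    then show "wp B n (load_prog 2 3;; IfLess 11 8 (Add 6 3 11) Skip;; Add 3 3 1)
        (?Inv (Suc l)) s'"
      using inv s l frameD[OF fr]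
      by (intro wp_load wp_intros) (auto simp: frame_set_reg less_Suc_eq)
  qed (use s Q in \<open>auto simp: frame_refl frame_set_reg frameD\<close>)
  then show ?thesis
    unfolding find_nbr_prog_def using word s by (intro wp_Seq wp_LoadConst wp_Add) auto
qed

text \<open>Decides whether a neighbour of \<open>u\<close> is to be added. For \<open>b\<close>
  other than 0 this singles out \<open>far\<close>; for \<open>b = 0\<close> the vertex
  \<open>w\<close> is included, as needed for \<open>far'\<close> when \<open>far\<close> is
  empty.\<close>

definition selected :: "nat \<Rightarrow> nat \<Rightarrow> nat \<Rightarrow> bool" where
  "selected w b u \<longleftrightarrow> (if u = w then b = 0 else \<not> A w u)"

lemma wp_far_test_prog:
  assumes s: "cells (mem s)" "reg s 0 = n" "reg s 2 < n" "reg s 4 < n" "reg s 11 = 0" "reg s 9 < B"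
    and Q: "\<And>s'. frame s s' \<Longrightarrow> reg s' 8 < 1 \<longleftrightarrow> selected (reg s 4) (reg s 9) (reg s 2) \<Longrightarrow> Q s'"
  shows "wp B n far_test_prog Q s"
  unfolding far_test_prog_def using s
  by (intro wp_load wp_intros) (auto simp: frame_set_reg frame_refl selected_def intro!: Q)

text \<open>The intersection with \<open>{..<n}\<close> only matters for \<open>n = 0\<close>, where \<open>w = 0\<close> is not a vertex.\<close>

definition hubs :: "nat \<Rightarrow> nat \<Rightarrow> nat \<Rightarrow> nat set \<Rightarrow> bool" where
  "hubs w b k D \<longleftrightarrow> (\<exists>f. (\<forall>u<k. selected w b u \<longrightarrow> f u < n \<and> A u (f u)) \<and>
     D = {..<n} \<inter> insert w (f ` {u. u < k \<and> selected w b u}))"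

lemma hubs_Suc_skip: "hubs w b k D \<Longrightarrow> \<not> selected w b k \<Longrightarrow> hubs w b (Suc k) D"
proof -
  assume "\<not> selected w b k"
  then have "{u. u < Suc k \<and> selected w b u} = {u. u < k \<and> selected w b u}"
    by (auto simp: less_Suc_eq)
  moreover assume "hubs w b k D"
  ultimately show ?thesis using \<open>\<not> selected w b k\<close> by (auto simp: hubs_def less_Suc_eq)
qed

lemma hubs_Suc_insert:
  assumes "hubs w b k D" "selected w b k" "c < n" "A k c"
  shows "hubs w b (Suc k) ({..<n} \<inter> insert c D)"
proof -
  obtain f where f: "\<forall>u<k. selected w b u \<longrightarrow> f u < n \<and> A u (f u)"
    "D = {..<n} \<inter> insert w (f ` {u. u < k \<and> selected w b u})"
    using assms(1) by (auto simp: hubs_def)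
  have "{u. u < Suc k \<and> selected w b u} = insert k {u. u < k \<and> selected w b u}"
    using assms(2) by (auto simp: less_Suc_eq)
  \<comment> \<open>The extended choice function changes only at \<open>k\<close>, which is not
    among the earlier vertices.\<close>
  moreover have "(f(k := c)) ` {u. u < k \<and> selected w b u} = f ` {u. u < k \<and> selected w b u}"
    by (intro image_cong) auto
  ultimately have "{..<n} \<inter> insert c D =
    {..<n} \<inter> insert w ((f(k := c)) ` {u. u < Suc k \<and> selected w b u})"
    using f(2) by auto
  moreover have "\<forall>u<Suc k. selected w b u \<longrightarrow> (f(k := c)) u < n \<and> A u ((f(k := c)) u)"
    using f(1) assms by (auto simp: less_Suc_eq)
  ultimately show ?thesis unfolding hubs_def by blast
qed

lemma wp_hubs_prog:
  assumes s: "cells (mem s)" "reg s 0 = n" "reg s 1 = 1" "0 < n \<Longrightarrow> reg s 4 < n" "reg s 4 \<le> n"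
      "reg s 11 = 0" "reg s 9 < B" "out (mem s) = {}"
    and Q: "\<And>s'. reg s' 0 = 1 \<Longrightarrow> hubs (reg s 4) (reg s 9) n (out (mem s')) \<Longrightarrow> Q s'"
      "\<And>s' u. reg s' 0 = 0 \<Longrightarrow> u < n \<Longrightarrow> selected (reg s 4) (reg s 9) u \<Longrightarrow> (\<forall>v<n. \<not> A u v) \<Longrightarrow> Q s'"
  shows "wp B n hubs_prog Q s"
proof -
  let ?w = "reg s 4" and ?b = "reg s 9"
  let ?frame = "\<lambda>k (s' :: ram_state). cells (mem s') \<and> reg s' 0 = n \<and> reg s' 1 = 1 \<and> reg s' 2 = k \<and>
    reg s' 4 = ?w \<and> reg s' 9 = ?b \<and> reg s' 11 = 0 \<and> reg s' 12 = n * n \<and> k \<le> n"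
  \<comment> \<open>Once register 10 is cleared it stays 0, with a selected isolated vertex as
    witness; the output cells no longer matter then.\<close>
  let ?res = "\<lambda>k (s' :: ram_state). reg s' 10 = 1 \<and> hubs ?w ?b k (out (mem s')) \<or>
    reg s' 10 = 0 \<and> (\<exists>u<n. selected ?w ?b u \<and> (\<forall>v<n. \<not> A u v))"
  let ?Inv = "\<lambda>k s'. ?frame k s' \<and> ?res k s'"
  let ?store = "IfLess 6 0 (Add 7 12 6;; Store 7 1) (LoadConst 10 0)"
  let ?upd = "IfLess 8 1 (find_nbr_prog;; ?store) Skip"
  have B: "0 < B" "1 < B" "n * n < B" "n < B" "n * n + ?w < B" using word s(5) by simp_all
  have "wp B n (WhileLess 2 0 (far_test_prog;; ?upd;; Add 2 2 1)) (wp B n (Add 0 10 11) Q)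
    (set_reg 2 0 (set_reg 10 1 (set_reg 7 (n * n + ?w)
      (set_reg 12 (n * n) s)\<lparr>mem := (mem s)(n * n + ?w := 1)\<rparr>)))"
  proof (rule wp_for[where Inv = ?Inv])
    fix k s1 assume k: "k < n" and inv: "?Inv k s1"
    have "wp B n (?upd;; Add 2 2 1) (?Inv (Suc k)) s2"
      if fr: "frame s1 s2" and sel: "reg s2 8 < 1 \<longleftrightarrow> selected ?w ?b k" for s2
    proof -
      have inv2: "?Inv k s2" using inv by (simp add: frameD[OF fr])
      have "wp B n ?store (\<lambda>s'. ?frame k s' \<and> ?res (Suc k) s') s3"
        if s3: "frame s2 s3" and sel: "selected ?w ?b k"
          and c: "reg s3 6 < n \<and> A k (reg s3 6) \<or> reg s3 6 = n \<and> (\<forall>v<n. \<not> A k v)" for s3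
      proof -
        have "n * n + reg s3 6 < B" using c word by auto
        moreover have "hubs ?w ?b (Suc k) (out ((mem s2)(n * n + reg s3 6 := Suc 0)))"
          if "reg s3 6 < n" "A k (reg s3 6)" "hubs ?w ?b k (out (mem s2))"
          using hubs_Suc_insert[OF that(3) sel that(1,2)] by (simp add: out_upd)
        ultimately show ?thesis
          using c inv2 frameD[OF s3] k sel B
          by (intro wp_intros) (auto simp: cells_upd)
      qed
      then have "wp B n ?upd (\<lambda>s'. ?frame k s' \<and> ?res (Suc k) s') s2"
        using inv2 sel k hubs_Suc_skip
        by (intro wp_IfLess[where i = 8] wp_Seq[of _ _ find_nbr_prog] wp_find_nbr_prog wp_Skip) auto
      moreover have "wp B n (Add 2 2 1) (?Inv (Suc k)) s'" if "?frame k s' \<and> ?res (Suc k) s'" for s'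
        using that k word by (intro wp_Add) auto
      ultimately show ?thesis by (rule wp_Seq[OF wp_mono])
    qed
    then show "wp B n (far_test_prog;; ?upd;; Add 2 2 1) (?Inv (Suc k)) s1"
      using inv k s by (intro wp_Seq[of _ _ far_test_prog] wp_far_test_prog) auto
  next
    fix s' assume "?Inv n s'"
    then show "wp B n (Add 0 10 11) Q s'" using B by (intro wp_Add) (auto intro: Q)
  qed (use s in \<open>auto simp: cells_upd out_upd hubs_def\<close>)
  then show ?thesis
    unfolding hubs_prog_def using B s
    by (intro wp_Seq wp_Mul wp_LoadConst wp_Add wp_Store) simp_all
qed

end

section \<open>Correctness and running time\<close>

text \<open>The syntactic cost of the program serves as the time bound \<open>T\<close>.\<close>

lemma minimum_set_solvable_in_timeI:
  assumes "\<And>n G. simple_graph G \<Longrightarrow> verts G = {..<n} \<Longrightarrow> \<G> G \<Longrightarrow>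
      wp ((n + 2) ^ k) n prog (\<lambda>s. correct_answer P G (decode_output n s)) (input_state G n)"
    and "(\<lambda>n. real (cost n prog)) \<in> O(f)"
  shows "minimum_set_solvable_in_time P \<G> f"
  unfolding minimum_set_solvable_in_time_def
  using assms unfolding wp_def
  by (intro exI[of _ prog] exI[of _ k] exI[of _ "\<lambda>n. cost n prog"]) blast

definition dominating_set_prog :: com where
  "dominating_set_prog = (max_degree_prog;; non_nbrs_prog)"

definition connected_dominating_set_prog :: com where
  "connected_dominating_set_prog = (max_degree_prog;; LoadConst 9 1;; hubs_prog)"

definition total_dominating_set_prog :: com where
  "total_dominating_set_prog =
     (max_degree_prog;; Add 6 5 1;; IfLess 6 0 (LoadConst 9 1) (LoadConst 9 0);; hubs_prog)"

lemmas prog_defs = dominating_set_prog_def connected_dominating_set_prog_def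
  total_dominating_set_prog_def max_degree_prog_def non_nbrs_prog_def hubs_prog_def
  degree_prog_def far_test_prog_def find_nbr_prog_def load_prog_def

text \<open>Loops are nested at most twice, so the costs are quadratic polynomials in
  \<open>n\<close>.\<close>

lemma cost_cubic:
  "(\<lambda>n. real (cost n dominating_set_prog)) \<in> O(\<lambda>n. real n ^ 3)"
  "(\<lambda>n. real (cost n connected_dominating_set_prog)) \<in> O(\<lambda>n. real n ^ 3)"
  "(\<lambda>n. real (cost n total_dominating_set_prog)) \<in> O(\<lambda>n. real n ^ 3)"
  unfolding prog_defs by (simp_all, real_asymp+)

section \<open>The programs run on an \<open>H_graph\<close>-free split graph\<close>

locale split_input =
  fixes G :: "nat graph" and n :: nat
  assumes split: "split_graph G" and free: "induced_free H_graph G" and verts: "verts G = {..<n}"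
begin

lemma simple: "simple_graph G"
  using split by (simp add: split_graph_def)

sublocale matrix_ram "adj G" n "(n + 2) ^ 3"
proof
  show "n * n + n + 2 \<le> (n + 2) ^ 3" by (simp add: power3_eq_cube algebra_simps)
qed

lemma cells_input: "cells (mem (input_state G n))"
  using cell_less by (auto simp: cells_def input_state_def)

lemma out_input: "out (mem (input_state G n)) = {}"
  by (auto simp: out_def input_state_def)

lemma nbrs_eq: "nbrs G v = {u. u < n \<and> adj G v u}"
  using nbrs_subset[OF simple, of v] verts by (auto simp: nbrs_def)

text \<open>Passes from machine states to the locale \<open>max_degree_vertex\<close>. The facts
  about \<open>w\<close> are guarded by \<open>0 < n\<close>, since register 4 is no vertex of the
  empty graph.\<close>

lemma wp_max_degree_prog_input:
  assumes Q: "\<And>s. cells (mem s) \<Longrightarrow> out (mem s) = {} \<Longrightarrow> reg s 0 = n \<Longrightarrow> reg s 1 = 1 \<Longrightarrow>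
      reg s 11 = 0 \<Longrightarrow> reg s 4 \<le> n \<Longrightarrow> reg s 5 \<le> n \<Longrightarrow>
      (0 < n \<Longrightarrow> reg s 4 < n \<and> max_degree_vertex G (reg s 4) \<and> reg s 5 = card (nbrs G (reg s 4))) \<Longrightarrow>
      Q s"
  shows "wp ((n + 2) ^ 3) n max_degree_prog Q (input_state G n)"
proof (rule wp_max_degree_prog[OF cells_input])
  fix s :: ram_state assume s: "degs_ok n (mem (input_state G n)) s"
  have deg: "deg i = card (nbrs G i)" for i by (simp add: deg_def nbrs_eq)
  show "Q s"
  proof (rule Q)
    assume "0 < n"
    then show "reg s 4 < n \<and> max_degree_vertex G (reg s 4) \<and> reg s 5 = card (nbrs G (reg s 4))"
      using s split free verts by (auto simp: degs_ok_def max_degree_vertex_def deg)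
  qed (use s cells_input out_input in \<open>auto simp: degs_ok_def deg_def count_le\<close>)
qed (simp add: input_state_def)

lemma decode_output_eq: "decode_output n s = (if reg s 0 = 0 then None else Some (out (mem s)))"
  by (simp add: decode_output_def out_def)

lemma dominating_set_prog_correct:
  "wp ((n + 2) ^ 3) n dominating_set_prog
     (\<lambda>s. correct_answer dominating_set G (decode_output n s)) (input_state G n)"
  unfolding dominating_set_prog_def
proof (intro wp_Seq wp_max_degree_prog_input wp_non_nbrs_prog)
  fix s s' :: ram_state
  assume s: "0 < n \<Longrightarrow>
      reg s 4 < n \<and> max_degree_vertex G (reg s 4) \<and> reg s 5 = card (nbrs G (reg s 4))"
    and s': "reg s' 0 = 1" "out (mem s') = {v. v < n \<and> \<not> adj G (reg s 4) v}"
  have "minimum_set dominating_set G (out (mem s'))"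
  proof (cases "n = 0")
    case True
    then show ?thesis using s' verts by (simp add: minimum_set_def dominating_set_def)
  next
    case False
    then interpret max_degree_vertex G "reg s 4" using s by simp
    have "out (mem s') = verts G - nbrs G (reg s 4)" using s' verts by (auto simp: nbrs_def)
    then show ?thesis using minimum_dominating_set by simp
  qed
  then show "correct_answer dominating_set G (decode_output n s')"
    using s' by (simp add: correct_answer_def decode_output_eq)
qed auto

lemma hubs_imp_image:
  assumes "hubs w b n D" "w < n"
  shows "\<exists>f. (\<forall>u. u < n \<and> selected w b u \<longrightarrow> adj G u (f u)) \<and>
    D = insert w (f ` {u. u < n \<and> selected w b u})"
proof -
  obtain f where f: "\<forall>u<n. selected w b u \<longrightarrow> f u < n \<and> adj G u (f u)"
    "D = {..<n} \<inter> insert w (f ` {u. u < n \<and> selected w b u})"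
    using assms(1) unfolding hubs_def by blast
  then have "D = insert w (f ` {u. u < n \<and> selected w b u})" using assms(2) by auto
  with f(1) show ?thesis by auto
qed

lemma selected_far:
  assumes "max_degree_vertex G w" "b \<noteq> 0"
  shows "{u. u < n \<and> selected w b u} = max_degree_vertex.far G w"
proof -
  interpret max_degree_vertex G w by fact
  show ?thesis unfolding far_def verts selected_def nbrs_def using assms(2) by force
qed

text \<open>By \<open>far_eq_empty_iff\<close> the flag \<open>b\<close> is 0 exactly if
  \<open>far\<close> is empty, and then \<open>w\<close> is the only selected vertex.\<close>

lemma selected_far':
  assumes vx: "max_degree_vertex G w" and b: "b = 0 \<longleftrightarrow> n \<le> Suc (card (nbrs G w))"
  shows "{u. u < n \<and> selected w b u} = max_degree_vertex.far' G w"
proof -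
  interpret max_degree_vertex G w by fact
  have far: "far = {} \<longleftrightarrow> b = 0" unfolding far_eq_empty_iff b verts by simp
  show ?thesis
  proof (cases "b = 0")
    case True
    then have "far = {}" using far by simp
    then have "u = w" if "u < n" "\<not> adj G w u" for u
      using that verts by (auto simp: far_def nbrs_def)
    moreover have "w < n" using max_degree_vertex.w[OF vx] verts by simp
    ultimately show ?thesis
      using True \<open>far = {}\<close> by (auto simp: far'_def selected_def split: if_splits)
  next
    case False
    then show ?thesis using far selected_far[OF vx] by (simp add: far'_def)
  qed
qed

section \<open>Optimality of the computed sets and soundness of negative answers\<close>

lemma hubs_connected:
  assumes vx: "0 < n \<Longrightarrow> w < n \<and> max_degree_vertex G w" and b: "b \<noteq> 0" and D: "hubs w b n D"
  shows "minimum_set connected_dominating_set G D"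
proof (cases "n = 0")
  case True
  then have "D = {}" using D unfolding hubs_def by auto
  then show ?thesis using True verts
    by (simp add: minimum_set_def connected_dominating_set_def dominating_set_def
        connected_graph_def induced_subgraph_def)
next
  case False
  then interpret max_degree_vertex G w using vx by simp
  have "w < n" using vx False by simp
  then obtain f where f: "\<forall>u. u < n \<and> selected w b u \<longrightarrow> adj G u (f u)"
    and Df: "D = insert w (f ` {u. u < n \<and> selected w b u})"
    using hubs_imp_image[OF D] by blast
  have far: "{u. u < n \<and> selected w b u} = far"
    by (rule selected_far[OF _ b]) unfold_locales
  have "adj G u (f u)" if "u \<in> far" for u
    using f that unfolding far[symmetric] by simp
  then show ?thesis unfolding Df far by (rule minimum_connected_dominating_set)
qed

lemma hubs_total:
  assumes vx: "0 < n \<Longrightarrow> w < n \<and> max_degree_vertex G w"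
    and b: "b = 0 \<longleftrightarrow> n \<le> Suc (card (nbrs G w))" and D: "hubs w b n D"
  shows "minimum_set total_dominating_set G D"
proof (cases "n = 0")
  case True
  then have "D = {}" using D unfolding hubs_def by auto
  then show ?thesis using True verts by (simp add: minimum_set_def total_dominating_set_def)
next
  case False
  then interpret max_degree_vertex G w using vx by simp
  have "w < n" using vx False by simp
  then obtain f where f: "\<forall>u. u < n \<and> selected w b u \<longrightarrow> adj G u (f u)"
    and Df: "D = insert w (f ` {u. u < n \<and> selected w b u})"
    using hubs_imp_image[OF D] by blast
  have far': "{u. u < n \<and> selected w b u} = far'"
    by (rule selected_far'[OF _ b]) unfold_locales
  have "adj G u (f u)" if "u \<in> far'" for u
    using f that unfolding far'[symmetric] by simp
  then show ?thesis unfolding Df far' by (rule minimum_total_dominating_set)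
qed

lemma selected_isolated_connected:
  assumes vx: "max_degree_vertex G w" and b: "b \<noteq> 0"
    and u: "u < n" "selected w b u" "\<forall>v<n. \<not> adj G u v"
  shows "\<not> connected_dominating_set G D"
proof -
  interpret max_degree_vertex G w by fact
  show ?thesis
  proof (rule no_connected_dominating_set)
    show "u \<in> far" using u selected_far[OF vx b] by blast
    show "nbrs G u = {}" using u by (simp add: nbrs_eq)
  qed
qed

lemma selected_isolated_total:
  assumes vx: "max_degree_vertex G w" and b: "b = 0 \<longleftrightarrow> n \<le> Suc (card (nbrs G w))"
    and u: "u < n" "selected w b u" "\<forall>v<n. \<not> adj G u v"
  shows "\<not> total_dominating_set G D"
proof -
  interpret max_degree_vertex G w by fact
  show ?thesis
  proof (rule no_total_dominating_set)
    show "u \<in> far'" using u selected_far'[OF vx b] by blast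
    show "nbrs G u = {}" using u by (simp add: nbrs_eq)
  qed
qed

lemma wp_hubs_prog_input:
  assumes s: "cells (mem s)" "out (mem s) = {}" "reg s 0 = n" "reg s 1 = 1" "reg s 11 = 0"
      "reg s 4 \<le> n" "reg s 9 \<le> 1"
    and w: "0 < n \<Longrightarrow> reg s 4 < n"
    and found: "\<And>D. hubs (reg s 4) (reg s 9) n D \<Longrightarrow> minimum_set P G D"
    and infeasible: "\<And>u D. u < n \<Longrightarrow> selected (reg s 4) (reg s 9) u \<Longrightarrow> \<forall>v<n. \<not> adj G u v \<Longrightarrow> \<not> P G D"
  shows "wp ((n + 2) ^ 3) n hubs_prog (\<lambda>s. correct_answer P G (decode_output n s)) s"
proof (rule wp_hubs_prog)
  show "reg s 9 < (n + 2) ^ 3" using s(7) word by linarith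
qed (use s w found infeasible in \<open>simp_all add: correct_answer_def decode_output_eq\<close>)

lemma connected_dominating_set_prog_correct:
  "wp ((n + 2) ^ 3) n connected_dominating_set_prog
     (\<lambda>s. correct_answer connected_dominating_set G (decode_output n s)) (input_state G n)"
  unfolding connected_dominating_set_prog_def
proof (rule wp_Seq, rule wp_max_degree_prog_input, rule wp_Seq, rule wp_LoadConst)
  show "1 < (n + 2) ^ 3" using word by linarith
  fix s :: ram_state
  let ?s = "set_reg 9 1 s" and ?w = "reg s 4"
  assume s: "cells (mem s)" "out (mem s) = {}" "reg s 0 = n" "reg s 1 = 1" "reg s 11 = 0"
      "?w \<le> n" "reg s 5 \<le> n"
    and w: "0 < n \<Longrightarrow> ?w < n \<and> max_degree_vertex G ?w \<and> reg s 5 = card (nbrs G ?w)"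
  show "wp ((n + 2) ^ 3) n hubs_prog
    (\<lambda>s. correct_answer connected_dominating_set G (decode_output n s)) ?s"
  proof (rule wp_hubs_prog_input)
    show "minimum_set connected_dominating_set G D" if "hubs (reg ?s 4) (reg ?s 9) n D" for D
      using that w by (intro hubs_connected[of ?w 1]) simp_all
    show "\<not> connected_dominating_set G D"
      if "u < n" "selected (reg ?s 4) (reg ?s 9) u" "\<forall>v<n. \<not> adj G u v" for u D
      using that w by (intro selected_isolated_connected[of ?w 1 u]) simp_all
  qed (use s w in simp_all)
qed

lemma total_dominating_set_prog_correct:
  "wp ((n + 2) ^ 3) n total_dominating_set_prog
     (\<lambda>s. correct_answer total_dominating_set G (decode_output n s)) (input_state G n)"
  unfolding total_dominating_set_prog_def
proof (rule wp_Seq, rule wp_max_degree_prog_input, rule wp_Seq, rule wp_Add)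
  fix s :: ram_state
  let ?s = "set_reg 6 (reg s 5 + reg s 1) s" and ?w = "reg s 4"
  let ?P = "\<lambda>s. correct_answer total_dominating_set G (decode_output n s)"
  assume s: "cells (mem s)" "out (mem s) = {}" "reg s 0 = n" "reg s 1 = 1" "reg s 11 = 0"
      "?w \<le> n" "reg s 5 \<le> n"
    and w: "0 < n \<Longrightarrow> ?w < n \<and> max_degree_vertex G ?w \<and> reg s 5 = card (nbrs G ?w)"
  show "reg s 5 + reg s 1 < (n + 2) ^ 3" using s word by linarith
  have B: "0 < (n + 2) ^ 3" "1 < (n + 2) ^ 3" using word by linarith+
  have nbrs0: "n = 0 \<Longrightarrow> card (nbrs G ?w) = 0" by (simp add: nbrs_eq)
  have hubs: "wp ((n + 2) ^ 3) n hubs_prog ?P (set_reg 9 b ?s)"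
    if b: "b = 0 \<longleftrightarrow> n \<le> Suc (card (nbrs G ?w))" "b \<le> 1" for b
  proof (rule wp_hubs_prog_input)
    let ?t = "set_reg 9 b ?s"
    show "minimum_set total_dominating_set G D" if "hubs (reg ?t 4) (reg ?t 9) n D" for D
      using that w by (intro hubs_total[OF _ b(1)]) simp_all
    show "\<not> total_dominating_set G D"
      if "u < n" "selected (reg ?t 4) (reg ?t 9) u" "\<forall>v<n. \<not> adj G u v" for u D
      using that w by (intro selected_isolated_total[OF _ b(1), of u]) simp_all
  qed (use s w b in simp_all)
  \<comment> \<open>The test made by the program decides whether \<open>far\<close> is nonempty. For
    \<open>n = 0\<close> nothing ties register 5 to a degree, but both sides are false.\<close>
  have flag: "\<not> n \<le> Suc (card (nbrs G ?w)) \<longleftrightarrow> reg s 5 + reg s 1 < n"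
    using w s nbrs0 by (cases "n = 0") auto
  show "wp ((n + 2) ^ 3) n (IfLess 6 0 (LoadConst 9 1) (LoadConst 9 0);; hubs_prog) ?P ?s"
  proof (rule wp_Seq, rule wp_IfLess)
    assume "reg ?s 6 < reg ?s 0"
    then have "wp ((n + 2) ^ 3) n hubs_prog ?P (set_reg 9 1 ?s)"
      using flag s by (intro hubs) simp_all
    then show "wp ((n + 2) ^ 3) n (LoadConst 9 1) (wp ((n + 2) ^ 3) n hubs_prog ?P) ?s"
      using B by (intro wp_LoadConst)
  next
    assume "\<not> reg ?s 6 < reg ?s 0"
    then have "wp ((n + 2) ^ 3) n hubs_prog ?P (set_reg 9 0 ?s)"
      using flag s by (intro hubs) simp_all
    then show "wp ((n + 2) ^ 3) n (LoadConst 9 0) (wp ((n + 2) ^ 3) n hubs_prog ?P) ?s"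
      using B by (intro wp_LoadConst)
  qed
qed

end

theorem theorem7p5:
  "minimum_set_solvable_in_time dominating_set
     (\<lambda>G. split_graph G \<and> induced_free H_graph G) (\<lambda>n. real n ^ 3) \<and>
   minimum_set_solvable_in_time total_dominating_set
     (\<lambda>G. split_graph G \<and> induced_free H_graph G) (\<lambda>n. real n ^ 3) \<and>
   minimum_set_solvable_in_time connected_dominating_set
     (\<lambda>G. split_graph G \<and> induced_free H_graph G) (\<lambda>n. real n ^ 3)"
proof (intro conjI)
  show "minimum_set_solvable_in_time dominating_set
     (\<lambda>G. split_graph G \<and> induced_free H_graph G) (\<lambda>n. real n ^ 3)"
    using split_input.dominating_set_prog_correct cost_cubic(1)
    by (intro minimum_set_solvable_in_timeI[where k = 3]) (simp_all add: split_input_def)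
  show "minimum_set_solvable_in_time total_dominating_set
     (\<lambda>G. split_graph G \<and> induced_free H_graph G) (\<lambda>n. real n ^ 3)"
    using split_input.total_dominating_set_prog_correct cost_cubic(3)
    by (intro minimum_set_solvable_in_timeI[where k = 3]) (simp_all add: split_input_def)
  show "minimum_set_solvable_in_time connected_dominating_set
     (\<lambda>G. split_graph G \<and> induced_free H_graph G) (\<lambda>n. real n ^ 3)"
    using split_input.connected_dominating_set_prog_correct cost_cubic(2)
    by (intro minimum_set_solvable_in_timeI[where k = 3]) (simp_all add: split_input_def)
qed

end
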